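(* Let $t$ be a real number and let $G$ be a minimally $t$-tough graph such that $G = G_1 * G_2$ is the join of two (non-null) graphs $G_1$ and $G_2$. Let $t_2$ be the toughness of $G_2$. Suppose furthermore that $G_1$ contains a vertex of maximum degree in $G$, that is, there is a vertex $v\in V(G_1)$ with $d_G(v)=\Delta(G)$. Then $G_2$ is a $\lceil 2t_2\rceil$-regular, minimally tough graph and $\lceil 2t\rceil=\lceil 2t_2\rceil+|V(G_1)|$.
   Context: All graphs are finite, simple, and undirected; the null graph is the graph with no vertices. The join $G_1*G_2$ of two vertex-disjoint graphs is obtained from their disjoint union by adding all edges between $V(G_1)$ and $V(G_2)$. $d_G(v)$ is the degree of $v$ in $G$ and $\Delta(G)$ is the maximum degree of $G$. For a graph $H$, $c(H)$ denotes the number of connected components of $H$. A set $S\subseteq V(G)$ is a separator of $G$ if $c(G-S)\ge 2$. The toughness $\tau(G)$ of a graph $G$ is the minimum of $|S|/c(G-S)$ over all separators $S$ of $G$, with $\tau(G)=\infty$ if $G$ has no separators, that is, if $G$ is complete. (Disconnected graphs have toughness $0$.) For $t\in\mathbb{R}\cup\{\infty\}$, $G$ is minimally $t$-tough if $\tau(G)=t$ and $\tau(G-e)<t$ for every edge $e$ of $G$. $G$ is minimally tough if it is minimally $t$-tough for some $t\in\mathbb{R}\cup\{\infty\}$. The statement that a graph is $\lceil 2t_2\rceil$-regular includes that $t_2$ is finite. *)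

theory Defs
  imports Complex_Main "HOL-Library.Extended_Real"
begin

record 'a ugraph =
  verts :: "'a set"
  edges :: "'a set set"

definition simple_graph :: "'a ugraph \<Rightarrow> bool" where
  "simple_graph G \<longleftrightarrow>
     finite (verts G) \<and> (\<forall>e \<in> edges G. e \<subseteq> verts G \<and> card e = 2)"

definition graph_join :: "'a ugraph \<Rightarrow> 'a ugraph \<Rightarrow> 'a ugraph" where
  "graph_join G H =
     \<lparr> verts = verts G \<union> verts H,
       edges = edges G \<union> edges H \<union> {{u, v} | u v. u \<in> verts G \<and> v \<in> verts H} \<rparr>"

lemma simple_graph_join:
  assumes "simple_graph G" "simple_graph H" "verts G \<inter> verts H = {}"
  shows "simple_graph (graph_join G H)"
proof -
  have "card {u, v} = 2" if "u \<in> verts G" "v \<in> verts H" for u v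
    using that assms(3) by (subst card_2_iff) blast
  then show ?thesis
    using assms by (auto simp: simple_graph_def graph_join_def)
qed

definition vdegree :: "'a ugraph \<Rightarrow> 'a \<Rightarrow> nat" where
  "vdegree G v = card {e \<in> edges G. v \<in> e}"

definition max_degree :: "'a ugraph \<Rightarrow> nat" where
  "max_degree G = Max (vdegree G ` verts G)"

text \<open>The degree \<open>k\<close> is an integer because it is used with ceilings.\<close>

definition regular_graph :: "int \<Rightarrow> 'a ugraph \<Rightarrow> bool" where
  "regular_graph k G \<longleftrightarrow> (\<forall>v \<in> verts G. int (vdegree G v) = k)"

definition delete_verts :: "'a ugraph \<Rightarrow> 'a set \<Rightarrow> 'a ugraph" where
  "delete_verts G S = \<lparr> verts = verts G - S, edges = {e \<in> edges G. e \<inter> S = {}} \<rparr>"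

definition delete_edge :: "'a ugraph \<Rightarrow> 'a set \<Rightarrow> 'a ugraph" where
  "delete_edge G e = \<lparr> verts = verts G, edges = edges G - {e} \<rparr>"

definition connected_rel :: "'a ugraph \<Rightarrow> ('a \<times> 'a) set" where
  "connected_rel G =
     {(u, v). u \<in> verts G \<and> v \<in> verts G \<and> (u, v) \<in> {(x, y). {x, y} \<in> edges G}\<^sup>*}"

definition graph_components :: "'a ugraph \<Rightarrow> 'a set set" where
  "graph_components G = verts G // connected_rel G"

definition num_components :: "'a ugraph \<Rightarrow> nat" where
  "num_components G = card (graph_components G)"

definition separator :: "'a ugraph \<Rightarrow> 'a set \<Rightarrow> bool" where
  "separator G S \<longleftrightarrow> S \<subseteq> verts G \<and> num_components (delete_verts G S) \<ge> 2"

lemma finite_separators: "simple_graph G \<Longrightarrow> finite {S. separator G S}"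
  by (rule finite_subset[of _ "Pow (verts G)"]) (auto simp: separator_def simple_graph_def)

definition toughness :: "'a ugraph \<Rightarrow> ereal" where
  "toughness G =
     (if \<exists>S. separator G S
      then Min ((\<lambda>S. ereal (real (card S) / real (num_components (delete_verts G S))))
                ` {S. separator G S})
      else \<infinity>)"

definition minimally_t_tough :: "ereal \<Rightarrow> 'a ugraph \<Rightarrow> bool" where
  "minimally_t_tough t G \<longleftrightarrow>
     toughness G = t \<and> (\<forall>e \<in> edges G. toughness (delete_edge G e) < t)"

definition minimally_tough :: "'a ugraph \<Rightarrow> bool" where
  "minimally_tough G \<longleftrightarrow> (\<exists>t. t \<noteq> -\<infinity> \<and> minimally_t_tough t G)"

end

theory Submission
  imports Defs
begin

text \<open>
  The whole argument is about degrees.  The neighbourhood of a vertex separates it from its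
  non-neighbours, leaving at least two components; this is why every vertex of a graph of finite
  toughness \<open>t\<close> has degree at least \<open>2 * t\<close> (\<open>twice_toughness_le_degree\<close>, which also covers
  vertices adjacent to all others).

  In the join \<open>G\<close>, minimality yields a bound in the other direction at one end of each edge
  \<open>{x, y}\<close> between the two sides (\<open>degree_bound_at_join_edge\<close>).  A set \<open>S\<close> witnessing that
  deleting \<open>{x, y}\<close> lowers the toughness must make this edge a bridge of \<open>G - S\<close>.  In a join
  this is only possible if \<open>x\<close> or \<open>y\<close> is the sole survivor of its side, because two survivors on
  each side would put the edge on a 4-cycle.  Say \<open>x\<close> is alone; then \<open>x\<close> is adjacent to all
  survivors of the other side, so removing the edge leaves exactly two components, one of them
  \<open>{y}\<close>.  Thus \<open>card S < 2 * t\<close> and all neighbours of \<open>y\<close> except \<open>x\<close> lie in \<open>S\<close>, which gives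
  \<open>y\<close> degree below \<open>2 * t + 1\<close>.  The edges at a vertex of maximum degree in \<open>G1\<close> carry the
  bound over to every vertex of \<open>G2\<close>.  Together with the lower bound, all vertices of \<open>G2\<close> have
  degree \<open>\<lceil>2 * t\<rceil>\<close> in \<open>G\<close>, hence degree \<open>k = \<lceil>2 * t\<rceil> - card (verts G1)\<close> in \<open>G2\<close>.

  It remains to compare with the toughness \<open>t2\<close> of \<open>G2\<close>.  The lower degree bound in \<open>G2\<close> gives
  \<open>2 * t2 \<le> k\<close>; adding \<open>verts G1\<close> to an optimal separator of \<open>G2\<close> gives
  \<open>2 * t \<le> 2 * t2 + card (verts G1)\<close>, so \<open>k = \<lceil>2 * t2\<rceil>\<close>.  Finally, a \<open>k\<close>-regular graph with
  \<open>k - 1 < 2 * t2\<close> is automatically minimally tough: after deleting an edge at \<open>x\<close>, the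
  \<open>k - 1\<close> remaining neighbours of \<open>x\<close> isolate it.
\<close>

section \<open>Neighbourhoods and degrees\<close>

definition nbrs :: "'a ugraph \<Rightarrow> 'a \<Rightarrow> 'a set" where
  "nbrs G v = {u. {v, u} \<in> edges G}"

lemma nbrs_subset_verts: "simple_graph G \<Longrightarrow> nbrs G v \<subseteq> verts G"
  by (auto simp: nbrs_def simple_graph_def)

lemma not_in_own_nbrs: "simple_graph G \<Longrightarrow> v \<notin> nbrs G v"
  by (auto simp: nbrs_def simple_graph_def)

lemma finite_nbrs: "simple_graph G \<Longrightarrow> finite (nbrs G v)"
  using nbrs_subset_verts[of G v] by (auto simp: simple_graph_def intro: finite_subset)

lemma vdegree_eq_card_nbrs:
  assumes "simple_graph G"
  shows "vdegree G v = card (nbrs G v)"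
proof -
  have "{e \<in> edges G. v \<in> e} = (\<lambda>u. {v, u}) ` nbrs G v"
  proof (intro subset_antisym subsetI)
    fix e assume e: "e \<in> {e \<in> edges G. v \<in> e}"
    then have "card e = 2" using assms by (auto simp: simple_graph_def)
    then obtain a b where "e = {a, b}" by (auto simp: card_2_iff)
    with e obtain u where "e = {v, u}" by (auto simp: insert_commute)
    with e show "e \<in> (\<lambda>u. {v, u}) ` nbrs G v" by (auto simp: nbrs_def)
  qed (auto simp: nbrs_def)
  moreover have "inj_on (\<lambda>u. {v, u}) (nbrs G v)"
    by (auto simp: inj_on_def doubleton_eq_iff)
  ultimately show ?thesis
    by (simp add: vdegree_def card_image)
qed

lemma simple_graph_delete_verts: "simple_graph G \<Longrightarrow> simple_graph (delete_verts G S)"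
  by (auto simp: simple_graph_def delete_verts_def)

lemma simple_graph_delete_edge: "simple_graph G \<Longrightarrow> simple_graph (delete_edge G e)"
  by (auto simp: simple_graph_def delete_edge_def)

section \<open>Counting components\<close>

lemma connected_rel_refl: "v \<in> verts G \<Longrightarrow> (v, v) \<in> connected_rel G"
  by (simp add: connected_rel_def)

lemma connected_rel_edge:
  "simple_graph G \<Longrightarrow> {u, v} \<in> edges G \<Longrightarrow> (u, v) \<in> connected_rel G"
  by (auto simp: connected_rel_def simple_graph_def)

lemma connected_rel_sym:
  assumes "(u, v) \<in> connected_rel G" shows "(v, u) \<in> connected_rel G"
proof -
  have "sym ({(x, y). {x, y} \<in> edges G}\<^sup>*)"
    by (intro sym_rtrancl) (auto simp: sym_def insert_commute)
  then show ?thesis using assms by (auto simp: connected_rel_def dest: symD)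
qed

lemma connected_rel_trans:
  "(u, v) \<in> connected_rel G \<Longrightarrow> (v, w) \<in> connected_rel G \<Longrightarrow> (u, w) \<in> connected_rel G"
  by (auto simp: connected_rel_def)

lemma connected_rel_class_eq:
  assumes "(u, v) \<in> connected_rel G"
  shows "connected_rel G `` {u} = connected_rel G `` {v}"
  using connected_rel_trans[OF assms] connected_rel_trans[OF connected_rel_sym[OF assms]] by blast

lemma finite_graph_components: "simple_graph G \<Longrightarrow> finite (graph_components G)"
  by (auto simp: graph_components_def quotient_def simple_graph_def)

lemma num_components_le_card:
  assumes "finite A" and "\<And>v. v \<in> verts G \<Longrightarrow> \<exists>a\<in>A. (a, v) \<in> connected_rel G"
  shows "num_components G \<le> card A"
proof -
  have "graph_components G \<subseteq> (\<lambda>a. connected_rel G `` {a}) ` A"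
  proof
    fix C assume "C \<in> graph_components G"
    then obtain v where v: "v \<in> verts G" "C = connected_rel G `` {v}"
      by (auto simp: graph_components_def quotient_def)
    with assms(2) obtain a where "a \<in> A" "(a, v) \<in> connected_rel G" by blast
    moreover from this have "C = connected_rel G `` {a}"
      using v(2) connected_rel_class_eq by metis
    ultimately show "C \<in> (\<lambda>a. connected_rel G `` {a}) ` A" by simp
  qed
  then have "num_components G \<le> card ((\<lambda>a. connected_rel G `` {a}) ` A)"
    unfolding num_components_def using assms(1) by (intro card_mono) auto
  also have "\<dots> \<le> card A" using assms(1) by (rule card_image_le)
  finally show ?thesis .
qed

lemma two_le_num_components:
  assumes "simple_graph G" "u \<in> verts G" "v \<in> verts G" "(u, v) \<notin> connected_rel G"
  shows "2 \<le> num_components G"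
proof -
  have "connected_rel G `` {u} \<noteq> connected_rel G `` {v}"
    using assms(4) connected_rel_refl[OF assms(3)] by (metis Image_singleton_iff)
  then have "2 = card {connected_rel G `` {u}, connected_rel G `` {v}}" by simp
  also have "\<dots> \<le> num_components G"
    unfolding num_components_def
    using assms finite_graph_components
    by (intro card_mono) (auto simp: graph_components_def quotient_def)
  finally show ?thesis .
qed

section \<open>Separators and toughness\<close>

lemma toughness_le_ratio:
  assumes "simple_graph G" "separator G S"
  shows "toughness G \<le> ereal (real (card S) / real (num_components (delete_verts G S)))"
  unfolding toughness_def
  using assms finite_separators[OF assms(1)] by (auto intro!: Min_le)

lemma toughness_attained:
  assumes "simple_graph G" "separator G S"
  obtains S' where "separator G S'"
    "toughness G = ereal (real (card S') / real (num_components (delete_verts G S')))"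
proof -
  let ?f = "\<lambda>S. ereal (real (card S) / real (num_components (delete_verts G S)))"
  have "Min (?f ` {S. separator G S}) \<in> ?f ` {S. separator G S}"
    using assms finite_separators[OF assms(1)] by (intro Min_in) auto
  moreover have "toughness G = Min (?f ` {S. separator G S})"
    using assms by (auto simp: toughness_def)
  ultimately show ?thesis using that by auto
qed

lemma separator_if_toughness_finite:
  assumes "toughness G < \<infinity>"
  obtains S where "separator G S"
  using assms that by (auto simp: toughness_def split: if_splits)

text \<open>A separator leaves at least two components, so its ratio is at most half its size.\<close>

lemma toughness_le_half_separator:
  assumes "simple_graph G" "separator G S"
  shows "toughness G \<le> ereal (real (card S) / 2)"
proof -
  have "real (card S) / real (num_components (delete_verts G S)) \<le> real (card S) / 2"
    using assms(2) by (intro divide_left_mono) (auto simp: separator_def)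
  then show ?thesis
    using toughness_le_ratio[OF assms] by (meson ereal_less_eq(3) order_trans)
qed

lemma separator_if_isolating:
  assumes G: "simple_graph G" and S: "S \<subseteq> verts G" "nbrs G x \<subseteq> S"
    and x: "x \<in> verts G - S" and y: "y \<in> verts G - S" "x \<noteq> y"
  shows "separator G S"
proof -
  let ?H = "delete_verts G S"
  have "(x, y) \<notin> connected_rel ?H"
  proof
    assume "(x, y) \<in> connected_rel ?H"
    then have "(x, y) \<in> {(x, y). {x, y} \<in> edges ?H}\<^sup>*" by (simp add: connected_rel_def)
    with y(2) obtain z where "{x, z} \<in> edges ?H"
      by (auto elim: converse_rtranclE)
    then show False using S(2) by (auto simp: delete_verts_def nbrs_def)
  qed
  then have "2 \<le> num_components ?H"
    using x y by (intro two_le_num_components[OF simple_graph_delete_verts[OF G]])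
      (auto simp: delete_verts_def)
  with S show ?thesis by (simp add: separator_def)
qed

lemma toughness_le_half_nonadjacent:
  assumes G: "simple_graph G" and "u \<in> verts G" "v \<in> verts G" "u \<noteq> v" "{u, v} \<notin> edges G"
  shows "separator G (verts G - {u, v})"
    and "toughness G \<le> ereal ((real (card (verts G)) - 2) / 2)"
proof -
  show sep: "separator G (verts G - {u, v})"
    using assms nbrs_subset_verts[OF G, of u] not_in_own_nbrs[OF G, of u]
    by (intro separator_if_isolating[where x = u and y = v]) (auto simp: nbrs_def)
  have "finite (verts G)" using G by (simp add: simple_graph_def)
  then have "card {u, v} + card (verts G - {u, v}) = card (verts G)"
    using assms by (subst card_Un_disjoint[symmetric]) (auto intro: arg_cong[where f = card])
  then have "real (card (verts G - {u, v})) = real (card (verts G)) - 2"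
    using assms by simp
  then show "toughness G \<le> ereal ((real (card (verts G)) - 2) / 2)"
    using toughness_le_half_separator[OF G sep] by simp
qed

lemma nonadjacent_if_separator:
  assumes G: "simple_graph G" and "separator G S"
  obtains (nonadj) u v where "u \<in> verts G" "v \<in> verts G" "u \<noteq> v" "{u, v} \<notin> edges G"
proof (rule ccontr)
  assume no: "\<not> thesis"
  have complete: "{u, v} \<in> edges G" if uv: "u \<in> verts G" "v \<in> verts G" "u \<noteq> v" for u v
    using no nonadj[OF uv] by blast
  let ?H = "delete_verts G S"
  have "num_components ?H \<le> 1"
  proof (cases "verts ?H = {}")
    case True
    then show ?thesis using num_components_le_card[of "{}" ?H] by simp
  next
    case False
    then obtain a where a: "a \<in> verts ?H" by blast
    have "(a, v) \<in> connected_rel ?H" if "v \<in> verts ?H" for v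
    proof (cases "a = v")
      case False
      then have "{a, v} \<in> edges ?H" using a that complete by (auto simp: delete_verts_def)
      then show ?thesis by (rule connected_rel_edge[OF simple_graph_delete_verts[OF G]])
    qed (use that connected_rel_refl in auto)
    then show ?thesis using num_components_le_card[of "{a}" ?H] by simp
  qed
  with assms(2) show False by (simp add: separator_def)
qed

text \<open>
  A vertex with a non-neighbour is isolated by its neighbourhood.  A vertex adjacent to all
  others has degree \<open>card (verts G) - 1\<close>, and this is enough because twice the toughness of a
  non-complete graph is at most \<open>card (verts G) - 2\<close>.
\<close>

lemma twice_toughness_le_degree:
  assumes G: "simple_graph G" and t: "toughness G = ereal t" and w: "w \<in> verts G"
  shows "2 * t \<le> real (vdegree G w)"
proof (cases "verts G \<subseteq> insert w (nbrs G w)")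
  case True
  obtain S where "separator G S" using separator_if_toughness_finite[of G] t by auto
  then obtain u v where "u \<in> verts G" "v \<in> verts G" "u \<noteq> v" "{u, v} \<notin> edges G"
    using nonadjacent_if_separator[OF G] by blast
  then have "2 * t \<le> real (card (verts G)) - 2"
    using toughness_le_half_nonadjacent(2)[OF G] t by fastforce
  moreover have "card (verts G) \<le> Suc (card (nbrs G w))"
    using card_mono[OF _ True] finite_nbrs[OF G, of w] not_in_own_nbrs[OF G, of w] by simp
  ultimately show ?thesis using vdegree_eq_card_nbrs[OF G] by simp
next
  case False
  then obtain z where "z \<in> verts G" "z \<noteq> w" "z \<notin> nbrs G w" by blast
  then have "separator G (nbrs G w)"
    using w nbrs_subset_verts[OF G] not_in_own_nbrs[OF G]
    by (intro separator_if_isolating[OF G, where x = w and y = z]) auto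
  from toughness_le_half_separator[OF G this] show ?thesis
    using t vdegree_eq_card_nbrs[OF G] by simp
qed

text \<open>
  The neighbours of \<open>x\<close> other than \<open>y\<close> isolate \<open>x\<close> once the edge \<open>{x, y}\<close> is gone; in a
  \<open>\<lceil>2 * t\<rceil>\<close>-regular graph there are fewer than \<open>2 * t\<close> of them.
\<close>

lemma minimally_t_tough_if_regular:
  assumes G: "simple_graph G" and t: "toughness G = ereal t"
    and reg: "regular_graph \<lceil>2 * t\<rceil> G"
  shows "minimally_t_tough (ereal t) G"
  unfolding minimally_t_tough_def
proof (intro conjI ballI)
  fix e assume e: "e \<in> edges G"
  then have "card e = 2" using G by (simp add: simple_graph_def)
  then obtain x y where xy: "e = {x, y}" "x \<noteq> y" by (auto simp: card_2_iff)
  then have V: "x \<in> verts G" "y \<in> verts G" using e G by (auto simp: simple_graph_def)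
  let ?H = "delete_edge G e" and ?S = "nbrs G x - {y}"
  have H: "simple_graph ?H" by (rule simple_graph_delete_edge[OF G])
  have "separator ?H ?S"
    using V xy nbrs_subset_verts[OF G, of x] not_in_own_nbrs[OF G, of x]
    by (intro separator_if_isolating[OF H, where x = x and y = y])
      (auto simp: delete_edge_def nbrs_def)
  then have "toughness ?H \<le> ereal (real (card ?S) / 2)"
    by (rule toughness_le_half_separator[OF H])
  also have "\<dots> < ereal t"
  proof -
    have y: "y \<in> nbrs G x" using e xy by (simp add: nbrs_def)
    then have "card (nbrs G x) = Suc (card ?S)"
      using finite_nbrs[OF G] by (metis card.remove)
    moreover have "int (card (nbrs G x)) = \<lceil>2 * t\<rceil>"
      using reg V vdegree_eq_card_nbrs[OF G] by (simp add: regular_graph_def)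
    ultimately have "real (card ?S) < 2 * t" by linarith
    then show ?thesis by simp
  qed
  finally show "toughness ?H < ereal t" .
qed (rule t)

section \<open>Minimally tough joins\<close>

lemma graph_join_commute: "graph_join G H = graph_join H G"
  by (auto simp: graph_join_def insert_commute)

lemma join_edge: "u \<in> verts G \<Longrightarrow> v \<in> verts H \<Longrightarrow> {u, v} \<in> edges (graph_join G H)"
  by (auto simp: graph_join_def)

lemma nbrs_join_right:
  assumes "simple_graph G1" "simple_graph G2" "verts G1 \<inter> verts G2 = {}" "y \<in> verts G2"
  shows "nbrs (graph_join G1 G2) y = nbrs G2 y \<union> verts G1"
  using assms by (auto simp: nbrs_def graph_join_def simple_graph_def doubleton_eq_iff)

lemma delete_verts_join_left:
  assumes "simple_graph G1" "simple_graph G2" "verts G1 \<inter> verts G2 = {}"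
  shows "delete_verts (graph_join G1 G2) (verts G1 \<union> S) = delete_verts G2 S"
proof -
  have "e \<inter> verts G1 \<noteq> {}" if "e \<in> edges G1" for e
  proof -
    have "card e = 2" "e \<subseteq> verts G1" using that assms(1) by (auto simp: simple_graph_def)
    then show ?thesis by (auto simp: card_2_iff)
  qed
  moreover have "e \<inter> verts G1 = {}" if "e \<in> edges G2" for e
    using that assms(2,3) unfolding simple_graph_def by blast
  ultimately show ?thesis
    using assms(3) by (auto simp: delete_verts_def graph_join_def)
qed

text \<open>
  Deleting \<open>verts G1\<close> reduces \<open>G\<close> to \<open>G2\<close>, so a best separator of \<open>G2\<close> extends to one of the
  join at an extra cost of \<open>card (verts G1)\<close>, shared by at least two components.
\<close>

lemma toughness_join_le:
  assumes G1: "simple_graph G1" and G2: "simple_graph G2"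
    and disj: "verts G1 \<inter> verts G2 = {}"
    and t: "toughness (graph_join G1 G2) = ereal t" and t2: "toughness G2 = ereal t2"
  shows "2 * t \<le> 2 * t2 + real (card (verts G1))"
proof -
  let ?G = "graph_join G1 G2"
  have G: "simple_graph ?G" using G1 G2 disj by (rule simple_graph_join)
  obtain S0 where "separator G2 S0" using separator_if_toughness_finite[of G2] t2 by auto
  then obtain S where S: "separator G2 S"
    and t2S: "t2 = real (card S) / real (num_components (delete_verts G2 S))"
    using toughness_attained[OF G2] t2 by (metis ereal.inject)
  define c where "c = num_components (delete_verts G2 S)"
  have c: "2 \<le> c" using S by (simp add: c_def separator_def)
  have dv: "delete_verts ?G (verts G1 \<union> S) = delete_verts G2 S"
    by (rule delete_verts_join_left[OF G1 G2 disj])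
  have SV: "S \<subseteq> verts G2" using S by (simp add: separator_def)
  have "separator ?G (verts G1 \<union> S)"
    using S SV dv by (auto simp: separator_def graph_join_def)
  from toughness_le_ratio[OF G this]
  have "t \<le> real (card (verts G1 \<union> S)) / real c"
    by (simp add: t dv c_def)
  also have "\<dots> = real (card (verts G1)) / real c + t2"
  proof -
    have "card (verts G1 \<union> S) = card (verts G1) + card S"
      using SV disj G1 G2
      by (intro card_Un_disjoint) (auto simp: simple_graph_def intro: finite_subset)
    then show ?thesis by (simp add: t2S c_def add_divide_distrib)
  qed
  also have "\<dots> \<le> real (card (verts G1)) / 2 + t2"
    using c by (intro add_right_mono divide_left_mono) auto
  finally show ?thesis by simp
qed

text \<open>
  If \<open>x\<close> is all that \<open>S\<close> leaves of \<open>G1\<close>, then without the edge \<open>{x, y}\<close> it is still adjacent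
  to every remaining vertex of \<open>G2\<close> other than \<open>y\<close>.  Hence there are at most two components,
  and only one if \<open>y\<close> has a further surviving neighbour.
\<close>

lemma separator_with_lone_survivor:
  assumes G1: "simple_graph G1" and G2: "simple_graph G2"
    and disj: "verts G1 \<inter> verts G2 = {}" and G: "G = graph_join G1 G2"
    and y: "y \<in> verts G2" "y \<notin> S" and x: "verts G1 - S = {x}"
    and sep: "separator (delete_edge G {x, y}) S"
  shows "num_components (delete_verts (delete_edge G {x, y}) S) \<le> 2"
    and "nbrs G y \<subseteq> insert x S"
proof -
  let ?H = "delete_verts (delete_edge G {x, y}) S"
  have sG: "simple_graph G" unfolding G using G1 G2 disj by (rule simple_graph_join)
  have H: "simple_graph ?H"
    by (intro simple_graph_delete_verts simple_graph_delete_edge sG)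
  have V: "verts ?H = insert x (verts G2 - S)"
    using x by (auto simp: delete_verts_def delete_edge_def G graph_join_def)
  have star: "(x, v) \<in> connected_rel ?H" if "v \<in> verts ?H" "v \<noteq> y" for v
  proof (cases "v = x")
    case False
    then have "{x, v} \<in> edges ?H"
      using that V x disj join_edge[of x G1 v G2]
      by (auto simp: delete_verts_def delete_edge_def G doubleton_eq_iff)
    then show ?thesis by (rule connected_rel_edge[OF H])
  qed (use that connected_rel_refl in auto)
  have "num_components ?H \<le> card {x, y}"
    using star connected_rel_refl[of y ?H] by (intro num_components_le_card) auto
  also have "\<dots> \<le> 2" by (simp add: card_insert_if)
  finally show "num_components ?H \<le> 2" .
  show "nbrs G y \<subseteq> insert x S"
  proof (rule ccontr)
    assume "\<not> nbrs G y \<subseteq> insert x S"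
    then obtain z where z: "{y, z} \<in> edges G" "z \<noteq> x" "z \<notin> S" by (auto simp: nbrs_def)
    have "y \<noteq> x" using x y disj by auto
    with z y have "{z, y} \<in> edges ?H"
      by (auto simp: delete_verts_def delete_edge_def doubleton_eq_iff insert_commute)
    then have zy: "(z, y) \<in> connected_rel ?H" by (rule connected_rel_edge[OF H])
    have "z \<noteq> y" using z(1) sG by (auto simp: simple_graph_def)
    then have "(x, z) \<in> connected_rel ?H"
      using star[of z] zy by (auto simp: connected_rel_def)
    then have "(x, y) \<in> connected_rel ?H" using zy by (rule connected_rel_trans)
    then have "num_components ?H \<le> card {x}"
      using star by (intro num_components_le_card) auto
    then show False using sep by (simp add: separator_def)
  qed
qed

text \<open>
  With a second survivor \<open>x'\<close> and \<open>y'\<close> on both sides, the path through \<open>x\<close>, \<open>y'\<close>, \<open>x'\<close> and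
  \<open>y\<close> replaces the edge \<open>{x, y}\<close>, and every other survivor is adjacent to \<open>x'\<close> or \<open>y'\<close>; so
  \<open>S\<close> would not separate.
\<close>

lemma separator_of_join_minus_edge:
  assumes G1: "simple_graph G1" and G2: "simple_graph G2"
    and disj: "verts G1 \<inter> verts G2 = {}" and G: "G = graph_join G1 G2"
    and x: "x \<in> verts G1 - S" and y: "y \<in> verts G2 - S"
    and sep: "separator (delete_edge G {x, y}) S"
  shows "verts G1 - S = {x} \<or> verts G2 - S = {y}"
proof (rule ccontr)
  assume no: "\<not> ?thesis"
  obtain x' where x': "x' \<in> verts G1 - S" "x' \<noteq> x" using no x by blast
  obtain y' where y': "y' \<in> verts G2 - S" "y' \<noteq> y" using no y by blast
  let ?H = "delete_verts (delete_edge G {x, y}) S"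
  have H: "simple_graph ?H"
    unfolding G
    by (intro simple_graph_delete_verts simple_graph_delete_edge simple_graph_join G1 G2 disj)
  have cross: "(u, v) \<in> connected_rel ?H"
    if "u \<in> verts G1 - S" "v \<in> verts G2 - S" "u \<noteq> x \<or> v \<noteq> y" for u v
  proof -
    have "u \<noteq> y" using that y disj by auto
    then have "{u, v} \<in> edges ?H"
      using that join_edge[of u G1 v G2]
      by (auto simp: delete_verts_def delete_edge_def G doubleton_eq_iff)
    then show ?thesis by (rule connected_rel_edge[OF H])
  qed
  have "(x', v) \<in> connected_rel ?H" if "v \<in> verts ?H" for v
  proof -
    consider "v \<in> verts G1 - S" | "v \<in> verts G2 - S"
      using \<open>v \<in> verts ?H\<close> by (auto simp: delete_verts_def delete_edge_def G graph_join_def)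
    then show ?thesis
    proof cases
      case 1
      then have "(v, y') \<in> connected_rel ?H" using cross y' by blast
      moreover have "(x', y') \<in> connected_rel ?H" using cross x' y' by blast
      ultimately show ?thesis by (blast intro: connected_rel_trans connected_rel_sym)
    next
      case 2
      then show ?thesis using cross x' by blast
    qed
  qed
  then have "num_components ?H \<le> card {x'}" by (intro num_components_le_card) auto
  then show False using sep by (simp add: separator_def)
qed

text \<open>
  Which end gets the bound depends on where the witnessing separator leaves a lone survivor: it
  is the end on the opposite side, since its neighbours other than that survivor lie in the
  separator, which has fewer than \<open>2 * t\<close> elements.
\<close>

lemma degree_bound_at_join_edge:
  assumes G1: "simple_graph G1" and G2: "simple_graph G2"
    and disj: "verts G1 \<inter> verts G2 = {}" and G: "G = graph_join G1 G2"
    and min: "minimally_t_tough (ereal t) G"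
    and x: "x \<in> verts G1" and y: "y \<in> verts G2"
  shows "real (vdegree G x) < 2 * t + 1 \<or> real (vdegree G y) < 2 * t + 1"
proof -
  have sG: "simple_graph G" unfolding G using G1 G2 disj by (rule simple_graph_join)
  let ?D = "delete_edge G {x, y}"
  have sD: "simple_graph ?D" by (rule simple_graph_delete_edge[OF sG])
  have tG: "toughness G = ereal t" using min by (simp add: minimally_t_tough_def)
  have "{x, y} \<in> edges G" unfolding G using x y by (rule join_edge)
  then have less: "toughness ?D < ereal t" using min by (simp add: minimally_t_tough_def)
  then obtain S0 where "separator ?D S0"
    using separator_if_toughness_finite[of ?D] by (metis less_ereal.simps(4) order_less_trans)
  then obtain S where S: "separator ?D S"
    and ratio: "real (card S) / real (num_components (delete_verts ?D S)) < t"
    using toughness_attained[OF sD] less by (metis less_ereal.simps(1))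
  have "finite S"
    using S sD by (auto simp: separator_def simple_graph_def intro: finite_subset)
  have survive: "x \<notin> S \<and> y \<notin> S"
  proof (rule ccontr)
    \<comment> \<open>Otherwise the deletion of \<open>S\<close> also removes the edge, so \<open>S\<close> has the same ratio in \<open>G\<close>.\<close>
    assume "\<not> (x \<notin> S \<and> y \<notin> S)"
    then have "delete_verts ?D S = delete_verts G S"
      by (auto simp: delete_verts_def delete_edge_def)
    moreover from this have "separator G S"
      using S by (simp add: separator_def delete_edge_def)
    ultimately show False
      using toughness_le_ratio[OF sG, of S] ratio tG by simp
  qed
  have bound: "real (vdegree G w) < 2 * t + 1"
    if "num_components (delete_verts ?D S) \<le> 2" "nbrs G w \<subseteq> insert z S" for w z
  proof -
    have "num_components (delete_verts ?D S) = 2" using that(1) S by (simp add: separator_def)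
    then have "real (card S) < 2 * t" using ratio by simp
    moreover have "card (nbrs G w) \<le> card (insert z S)"
      using that(2) \<open>finite S\<close> by (intro card_mono) auto
    moreover have "card (insert z S) \<le> Suc (card S)" by (rule card_insert_le_m1) auto
    ultimately show ?thesis using vdegree_eq_card_nbrs[OF sG, of w] by linarith
  qed
  consider "verts G1 - S = {x}" | "verts G2 - S = {y}"
    using separator_of_join_minus_edge[OF G1 G2 disj G _ _ S] x y survive by blast
  then show ?thesis
  proof cases
    case 1
    then show ?thesis
      using separator_with_lone_survivor[OF G1 G2 disj G y _ 1 S] survive bound[of y x] by blast
  next
    case 2
    have S': "separator (delete_edge G {y, x}) S" using S by (simp add: insert_commute)
    have G': "G = graph_join G2 G1" unfolding G by (rule graph_join_commute)
    have disj': "verts G2 \<inter> verts G1 = {}" using disj by blast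
    show ?thesis
      using separator_with_lone_survivor[OF G2 G1 disj' G' x _ 2 S'] survive bound[of x y]
      by (simp add: insert_commute)
  qed
qed

theorem theorem5p1:
  fixes G G1 G2 :: "'a ugraph" and t :: real
  assumes "simple_graph G1" and "simple_graph G2"
    and "verts G1 \<noteq> {}" and "verts G2 \<noteq> {}"
    and "verts G1 \<inter> verts G2 = {}"
    and "G = graph_join G1 G2"
    and "minimally_t_tough (ereal t) G"
    and "\<exists>v \<in> verts G1. vdegree G v = max_degree G"
  shows "\<exists>t2 :: real. toughness G2 = ereal t2
           \<and> regular_graph \<lceil>2 * t2\<rceil> G2
           \<and> minimally_tough G2
           \<and> \<lceil>2 * t\<rceil> = \<lceil>2 * t2\<rceil> + int (card (verts G1))"
proof -
  note G1 = assms(1) and G2 = assms(2) and disj = assms(5) and G = assms(6)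
  have sG: "simple_graph G" unfolding G using G1 G2 disj by (rule simple_graph_join)
  have VG: "verts G = verts G1 \<union> verts G2" by (simp add: G graph_join_def)
  have fin: "finite (verts G1)" "finite (verts G2)" using G1 G2 by (auto simp: simple_graph_def)
  have tG: "toughness G = ereal t" using assms(7) by (simp add: minimally_t_tough_def)
  obtain v where v: "v \<in> verts G1" "vdegree G v = max_degree G" using assms(8) by blast

  \<comment> \<open>Of the two ends of the edge \<open>{v, y}\<close>, \<open>y\<close> has the smaller degree.\<close>
  have upper: "real (vdegree G y) < 2 * t + 1" if y: "y \<in> verts G2" for y
  proof -
    have "vdegree G y \<le> vdegree G v"
      unfolding v(2) max_degree_def using fin y VG by (intro Max_ge) auto
    then show ?thesis
      using degree_bound_at_join_edge[OF G1 G2 disj G assms(7) v(1) y] by linarith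
  qed
  have degG: "int (vdegree G y) = \<lceil>2 * t\<rceil>" if y: "y \<in> verts G2" for y
    using upper[OF y] twice_toughness_le_degree[OF sG tG, of y] y VG by simp linarith
  have deg_split: "vdegree G y = vdegree G2 y + card (verts G1)" if y: "y \<in> verts G2" for y
  proof -
    have "card (nbrs G2 y \<union> verts G1) = card (nbrs G2 y) + card (verts G1)"
      using finite_nbrs[OF G2] fin nbrs_subset_verts[OF G2, of y] disj
      by (intro card_Un_disjoint) auto
    then show ?thesis
      using nbrs_join_right[OF G1 G2 disj y, folded G]
      by (simp add: vdegree_eq_card_nbrs[OF sG] vdegree_eq_card_nbrs[OF G2])
  qed
  obtain y0 where y0: "y0 \<in> verts G2" using assms(4) by blast

  \<comment> \<open>In a complete \<open>G2\<close>, \<open>y0\<close> would be adjacent to all of \<open>G\<close>, too many for \<open>upper\<close>.\<close>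
  have "\<exists>S. separator G2 S"
  proof (rule ccontr)
    assume no: "\<not> ?thesis"
    have "{y0, u} \<in> edges G2" if "u \<in> verts G2" "u \<noteq> y0" for u
      using no toughness_le_half_nonadjacent(1)[OF G2 y0, of u] that by blast
    then have "verts G \<subseteq> insert y0 (nbrs G y0)"
      unfolding G nbrs_join_right[OF G1 G2 disj y0]
      by (auto simp: nbrs_def graph_join_def)
    then have "card (verts G) \<le> card (insert y0 (nbrs G y0))"
      using finite_nbrs[OF sG] by (intro card_mono) auto
    then have "card (verts G) \<le> Suc (vdegree G y0)"
      using finite_nbrs[OF sG, of y0] not_in_own_nbrs[OF sG, of y0]
      by (simp add: vdegree_eq_card_nbrs[OF sG])
    moreover obtain S where "separator G S"
      using separator_if_toughness_finite[of G] tG by auto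
    then obtain a b where "a \<in> verts G" "b \<in> verts G" "a \<noteq> b" "{a, b} \<notin> edges G"
      using nonadjacent_if_separator[OF sG] by blast
    then have "2 * t \<le> real (card (verts G)) - 2"
      using toughness_le_half_nonadjacent(2)[OF sG] tG by fastforce
    ultimately show False using upper[OF y0] by linarith
  qed
  then obtain t2 where t2: "toughness G2 = ereal t2"
    using toughness_attained[OF G2] by metis

  have "2 * t2 \<le> real (vdegree G2 y0)"
    by (rule twice_toughness_le_degree[OF G2 t2 y0])
  moreover have "2 * t \<le> 2 * t2 + real (card (verts G1))"
    using toughness_join_le[OF G1 G2 disj _ t2] tG G by simp
  ultimately have ceil: "\<lceil>2 * t\<rceil> = \<lceil>2 * t2\<rceil> + int (card (verts G1))"
    using degG[OF y0] deg_split[OF y0] by linarith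
  then have reg: "regular_graph \<lceil>2 * t2\<rceil> G2"
    using degG deg_split by (fastforce simp: regular_graph_def)
  then have "minimally_t_tough (ereal t2) G2"
    by (rule minimally_t_tough_if_regular[OF G2 t2])
  then have "minimally_tough G2"
    unfolding minimally_tough_def by (intro exI[of _ "ereal t2"]) simp
  with t2 reg ceil show ?thesis by blast
qed

end
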